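(* Let $m<n$ be positive integers, let $p_1,\dots,p_m\ge 1$ be integers with $\sum_{i=1}^m p_i=n$, and let $A\in\mathbb{R}^{m\times n}$ be a real matrix with columns partitioned as $A=[\boldsymbol a_{1,1},\dots,\boldsymbol a_{1,p_1}\mid\cdots\mid\boldsymbol a_{m,1},\dots,\boldsymbol a_{m,p_m}]$. If $A$ is individually Volterra-Lyapunov stable (with respect to this partition), then $A$ is D-stable (with respect to this partition). That is, there exists a block diagonal matrix $K\in\mathbb{R}^{n\times m}$ of the form described in the context such that for every non-negative diagonal matrix $E=\operatorname{diag}(\varepsilon_{1,1},\dots,\varepsilon_{m,p_m})\in\mathbb{R}^{n\times n}$ and every nonempty set $J$ of indices of blocks that are active for $E$, every eigenvalue of the principal submatrix $[AEK]_J$ has strictly positive real part.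
   Context: Column partition: the $n$ columns of $A$ are indexed by pairs $(i,r)$ with $1\le i\le m$, $1\le r\le p_i$, ordered lexicographically; $\boldsymbol a_{i,r}\in\mathbb{R}^m$ denotes the corresponding column. The rows are indexed by $1,\dots,m$. Squared matrices: for each tuple $\kappa=(\kappa_1,\dots,\kappa_m)$ with $\kappa_i\in\{1,\dots,p_i\}$, the corresponding squared matrix of $A$ is the $m\times m$ matrix $[A]^m_{s_\kappa}=[\boldsymbol a_{1,\kappa_1},\boldsymbol a_{2,\kappa_2},\dots,\boldsymbol a_{m,\kappa_m}]$, obtained by selecting exactly one column from each block. There are $N=\prod_{i=1}^m p_i$ of them. Individually Volterra-Lyapunov stable: for every squared matrix $[A]^m_{s_\kappa}$ there exists a diagonal matrix $D_\kappa\in\mathbb{R}^{m\times m}$ with strictly positive diagonal entries (which may depend on $\kappa$) such that the symmetric matrix $[A]^m_{s_\kappa}D_\kappa+D_\kappa([A]^m_{s_\kappa})^T$ is positive definite. Block diagonal matrix $K$: a matrix $K\in\mathbb{R}^{n\times m}$ with rows indexed by the pairs $(i,r)$ and columns by $1,\dots,m$, whose entry in row $(i,r)$ and column $i$ is a number $k_{i,r}\ge 0$, all other entries being zero. The matrix $E=\operatorname{diag}(\varepsilon_{1,1},\dots,\varepsilon_{1,p_1},\dots,\varepsilon_{m,1},\dots,\varepsilon_{m,p_m})$ has entries $\varepsilon_{i,r}\ge 0$, so that $AEK\in\mathbb{R}^{m\times m}$ has $i$-th column $\sum_{r=1}^{p_i}\varepsilon_{i,r}k_{i,r}\boldsymbol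 a_{i,r}$. Treatment of zeros in $E$: if $\varepsilon_{i,r}=0$, the corresponding column of $A$ and row of $K$ are considered inactive and removed from the product. If all $\varepsilon_{i,1},\dots,\varepsilon_{i,p_i}$ are zero, the whole block $i$ is deleted from the analysis. Accordingly, block $i$ is called active for $E$ if $\varepsilon_{i,r}>0$ for at least one $r$. For nonempty $J\subseteq\{1,\dots,m\}$, $[M]_J$ denotes the principal submatrix of $M\in\mathbb{R}^{m\times m}$ with rows and columns indexed by $J$. D-stable (extended sense, for $A\in\mathbb{R}^{m\times n}$ with $n>m$): there exists a block diagonal matrix $K\in\mathbb{R}^{n\times m}$ (rows indexed by the pairs $(i,r)$, columns by $1,\dots,m$, entry in row $(i,r)$ and column $i$ equal to a number $k_{i,r}\ge 0$, all other entries zero) such that for all non-negative diagonal $E\in\mathbb{R}^{n\times n}$ and all nonempty sets $J$ of indices of active blocks for $E$, all eigenvalues of $[AEK]_J$ have strictly positive real part. *)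

theory Defs
  imports
    Complex_Main
    "Jordan_Normal_Form.Matrix"
    "Jordan_Normal_Form.Char_Poly"
    "Jordan_Normal_Form.DL_Submatrix"
begin

text \<open>
  All indices are 0-based: blocks are \<open>i < m\<close> and the positions within block \<open>i\<close> are
  \<open>r < p i\<close>. The lexicographic order on the pairs \<open>(i, r)\<close> identifies them with
  \<open>{..<n}\<close>, where \<open>n = (\<Sum>i<m. p i)\<close>; the values of \<open>p\<close> at \<open>i \<ge> m\<close> are irrelevant.
\<close>

definition pair_index :: "(nat \<Rightarrow> nat) \<Rightarrow> nat \<Rightarrow> nat \<Rightarrow> nat" where
  "pair_index p i r = (\<Sum>j<i. p j) + r"

definition squared_matrix ::
    "nat \<Rightarrow> (nat \<Rightarrow> nat) \<Rightarrow> real mat \<Rightarrow> (nat \<Rightarrow> nat) \<Rightarrow> real mat" where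
  "squared_matrix m p A \<kappa> =
     mat_of_cols m (map (\<lambda>i. col A (pair_index p i (\<kappa> i))) [0..<m])"

definition sym_positive_definite :: "nat \<Rightarrow> real mat \<Rightarrow> bool" where
  "sym_positive_definite m M \<longleftrightarrow>
     M \<in> carrier_mat m m \<and> transpose_mat M = M \<and>
     (\<forall>x \<in> carrier_vec m. x \<noteq> 0\<^sub>v m \<longrightarrow> x \<bullet> (M *\<^sub>v x) > 0)"

definition volterra_lyapunov_stable :: "nat \<Rightarrow> real mat \<Rightarrow> bool" where
  "volterra_lyapunov_stable m M \<longleftrightarrow>
     (\<exists>D \<in> carrier_mat m m. diagonal_mat D \<and> (\<forall>i<m. D $$ (i, i) > 0) \<and>
        sym_positive_definite m (M * D + D * transpose_mat M))"

definition individually_VL_stable :: "nat \<Rightarrow> (nat \<Rightarrow> nat) \<Rightarrow> real mat \<Rightarrow> bool" where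
  "individually_VL_stable m p A \<longleftrightarrow>
     (\<forall>\<kappa>. (\<forall>i<m. \<kappa> i < p i) \<longrightarrow> volterra_lyapunov_stable m (squared_matrix m p A \<kappa>))"

definition block_diagonal_nonneg ::
    "nat \<Rightarrow> nat \<Rightarrow> (nat \<Rightarrow> nat) \<Rightarrow> real mat \<Rightarrow> bool" where
  "block_diagonal_nonneg m n p K \<longleftrightarrow>
     K \<in> carrier_mat n m \<and>
     (\<forall>i<m. \<forall>r<p i. \<forall>j<m.
        if j = i then K $$ (pair_index p i r, j) \<ge> 0
        else K $$ (pair_index p i r, j) = 0)"

definition nonneg_diagonal :: "nat \<Rightarrow> real mat \<Rightarrow> bool" where
  "nonneg_diagonal n E \<longleftrightarrow>
     E \<in> carrier_mat n n \<and> diagonal_mat E \<and> (\<forall>c<n. E $$ (c, c) \<ge> 0)"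

definition active_blocks :: "nat \<Rightarrow> (nat \<Rightarrow> nat) \<Rightarrow> real mat \<Rightarrow> nat set" where
  "active_blocks m p E =
     {i. i < m \<and> (\<exists>r<p i. E $$ (pair_index p i r, pair_index p i r) > 0)}"

definition positive_stable :: "real mat \<Rightarrow> bool" where
  "positive_stable M \<longleftrightarrow>
     (\<forall>z. eigenvalue (map_mat complex_of_real M) z \<longrightarrow> Re z > 0)"

text \<open>
  A column of \<open>A\<close> with zero weight in \<open>E\<close> contributes nothing to \<open>A * E * K\<close>, so it
  need not be removed explicitly; blocks all of whose weights vanish are removed by
  restricting to principal submatrices indexed by active blocks.
\<close>

definition D_stable :: "nat \<Rightarrow> nat \<Rightarrow> (nat \<Rightarrow> nat) \<Rightarrow> real mat \<Rightarrow> bool" where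
  "D_stable m n p A \<longleftrightarrow>
     (\<exists>K. block_diagonal_nonneg m n p K \<and>
        (\<forall>E J. nonneg_diagonal n E \<and> J \<noteq> {} \<and> J \<subseteq> active_blocks m p E \<longrightarrow>
           positive_stable (submatrix (A * E * K) J J)))"

end

theory Submission
  imports Defs
begin

text \<open>
  Take all entries of \<open>K\<close> in the block positions equal to one. Call \<open>e\<^sub>i\<close> or
  \<open>x + w e\<^sub>i\<close> with \<open>Re w \<ge> 0\<close> an admissible column \<open>i\<close>. If \<open>x\<close> is restricted to the given
  columns \<open>a\<^sub>i\<^sub>,\<^sub>r\<close>, the Volterra-Lyapunov inequality shows that every matrix with admissible
  columns is nonsingular. This survives replacing \<open>a\<^sub>i\<^sub>,\<^sub>r\<close> by a nonzero conic combination, one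
  column at a time: the determinant is a linear functional \<open>L\<close> of column \<open>i\<close>, and
  \<open>L (a\<^sub>i\<^sub>,\<^sub>r + w e\<^sub>i) \<noteq> 0\<close> for all \<open>w\<close> in the closed right half-plane means that
  \<open>L a\<^sub>i\<^sub>,\<^sub>r / L e\<^sub>i\<close> lies in the open right half-plane, which is a convex cone. An eigenvalue
  \<open>z\<close> of \<open>[AEK]\<^sub>J\<close> with \<open>Re z \<le> 0\<close> would make the admissible matrix with \<open>w = -z\<close> for columns
  in \<open>J\<close> and \<open>e\<^sub>i\<close> for the other columns singular.
\<close>

section \<open>Admissible columns and the determinant as a function of its columns\<close>

definition unit_col :: "nat \<Rightarrow> nat \<Rightarrow> complex" where
  "unit_col i = (\<lambda>j. if j = i then 1 else 0)"

definition shifted_col :: "nat \<Rightarrow> (nat \<Rightarrow> real) \<Rightarrow> complex \<Rightarrow> nat \<Rightarrow> complex" where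
  "shifted_col i x w = (\<lambda>j. of_real (x j) + w * unit_col i j)"

text \<open>\<open>unit_col i\<close> is the limiting direction of the shifted columns as
  \<open>w\<close> grows. It supplies the normalising value in the cone argument and fills the
  columns outside an index set \<open>J\<close>.\<close>

definition vertex_cols :: "nat \<Rightarrow> nat \<Rightarrow> (nat \<Rightarrow> nat \<Rightarrow> real) \<Rightarrow> (nat \<Rightarrow> complex) set" where
  "vertex_cols i q a = insert (unit_col i) {shifted_col i (a r) w |r w. r < q \<and> Re w \<ge> 0}"

text \<open>A positive weight is demanded because with all weights zero and \<open>w = 0\<close> the
  column would vanish.\<close>

definition cone_cols :: "nat \<Rightarrow> nat \<Rightarrow> (nat \<Rightarrow> nat \<Rightarrow> real) \<Rightarrow> (nat \<Rightarrow> complex) set" where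
  "cone_cols i q a = insert (unit_col i)
     {shifted_col i (\<lambda>j. \<Sum>r<q. t r * a r j) w |t w.
        (\<forall>r<q. t r \<ge> 0) \<and> (\<exists>r<q. t r > 0) \<and> Re w \<ge> 0}"

text \<open>\<open>c i\<close> is a whole column, so replacing one column is the function update
  \<open>c(i := x)\<close>.\<close>

definition col_det :: "nat \<Rightarrow> (nat \<Rightarrow> nat \<Rightarrow> complex) \<Rightarrow> complex" where
  "col_det m c = det (mat m m (\<lambda>(j, i). c i j))"

text \<open>The cofactors along column \<open>i\<close> do not involve that column, so Laplace
  expansion gives coefficients independent of \<open>x\<close>.\<close>

lemma col_det_linear:
  assumes "i < m"
  obtains f where "\<And>x. col_det m (c(i := x)) = (\<Sum>j<m. x j * f j)"
proof
  fix x
  let ?M = "\<lambda>x. mat m m (\<lambda>(j, k). (c(i := x)) k j)"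
  have cof: "cofactor (?M x) j i = cofactor (?M (c i)) j i" if "j < m" for j
  proof -
    have "mat_delete (?M x) j i = mat_delete (?M (c i)) j i"
      by (rule eq_matI) (auto simp: mat_delete_def)
    then show ?thesis by (simp add: cofactor_def)
  qed
  have "col_det m (c(i := x)) = (\<Sum>j<m. ?M x $$ (j, i) * cofactor (?M x) j i)"
    unfolding col_det_def by (rule laplace_expansion_column) (use assms in auto)
  also have "\<dots> = (\<Sum>j<m. x j * cofactor (?M (c i)) j i)"
    using assms by (intro sum.cong) (simp_all add: cof fun_upd_same del: fun_upd_apply fun_upd_triv)
  finally show "col_det m (c(i := x)) = (\<Sum>j<m. x j * cofactor (?M (c i)) j i)" .
qed

lemma col_det_eq_0_iff:
  "col_det m c = 0 \<longleftrightarrow>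
     (\<exists>v. (\<exists>i<m. v i \<noteq> 0) \<and> (\<forall>j<m. (\<Sum>i<m. c i j * v i) = 0))"
proof -
  have "col_det m c = 0 \<longleftrightarrow> (\<exists>v\<in>carrier_vec m. v \<noteq> 0\<^sub>v m \<and>
      mat m m (\<lambda>(j, i). c i j) *\<^sub>v v = 0\<^sub>v m)"
    unfolding col_det_def by (subst det_0_iff_vec_prod_zero[of _ m]) auto
  also have "\<dots> \<longleftrightarrow> (\<exists>v. (\<exists>i<m. v i \<noteq> 0) \<and> (\<forall>j<m. (\<Sum>i<m. c i j * v i) = 0))"
  proof (intro iffI; elim bexE exE conjE)
    fix v :: "complex vec"
    assume v: "v \<in> carrier_vec m" "v \<noteq> 0\<^sub>v m" "mat m m (\<lambda>(j, i). c i j) *\<^sub>v v = 0\<^sub>v m"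
    have "\<exists>i<m. v $ i \<noteq> 0"
      using v(1,2) by (metis carrier_vecD eq_vecI index_zero_vec)
    moreover have "(\<Sum>i<m. c i j * v $ i) = 0" if "j < m" for j
      using arg_cong[OF v(3), of "\<lambda>u. u $ j"] that v(1)
      by (simp add: scalar_prod_def lessThan_atLeast0)
    ultimately show "\<exists>v. (\<exists>i<m. v i \<noteq> 0) \<and> (\<forall>j<m. (\<Sum>i<m. c i j * v i) = 0)" by blast
  next
    fix v i assume v: "\<forall>j<m. (\<Sum>i<m. c i j * v i) = 0" and i: "i < m" "v i \<noteq> 0"
    have "vec m v \<noteq> 0\<^sub>v m" using i by (metis index_vec index_zero_vec(1))
    moreover have "mat m m (\<lambda>(j, i). c i j) *\<^sub>v vec m v = 0\<^sub>v m"
      using v by (intro eq_vecI) (auto simp: scalar_prod_def lessThan_atLeast0)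
    ultimately show "\<exists>v\<in>carrier_vec m. v \<noteq> 0\<^sub>v m \<and> mat m m (\<lambda>(j, i). c i j) *\<^sub>v v = 0\<^sub>v m"
      by (intro bexI[of _ "vec m v"]) auto
  qed
  finally show ?thesis .
qed

section \<open>From vertex columns to conic combinations\<close>

lemma linear_nonzero_on_cone_cols:
  fixes m :: nat and f :: "nat \<Rightarrow> complex"
  defines "L x \<equiv> (\<Sum>j<m. x j * f j)"
  assumes "i < m" and nz: "\<And>x. x \<in> vertex_cols i q a \<Longrightarrow> L x \<noteq> 0"
    and x: "x \<in> cone_cols i q a"
  shows "L x \<noteq> 0"
proof (cases "x = unit_col i")
  case True
  then show ?thesis by (simp add: nz vertex_cols_def)
next
  case False
  obtain t w where t: "\<And>r. r < q \<Longrightarrow> t r \<ge> 0" and pos: "\<exists>r<q. t r > 0" and w: "Re w \<ge> 0"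
    and x_eq: "x = shifted_col i (\<lambda>j. \<Sum>r<q. t r * a r j) w"
    using x False unfolding cone_cols_def by auto
  define g where "g = L (unit_col i)"
  define h where "h r = L (\<lambda>j. of_real (a r j)) / g" for r
  have g: "g \<noteq> 0" unfolding g_def by (rule nz) (simp add: vertex_cols_def)
  have L_shift: "L (shifted_col i y w) = L (\<lambda>j. of_real (y j)) + w * g" for y w
    by (simp add: L_def g_def shifted_col_def algebra_simps sum.distrib sum_distrib_left)
  have h: "Re (h r) > 0" if "r < q" for r
  proof (rule ccontr)
    \<comment> \<open>The shift \<open>- h r\<close> would then be allowed, and it makes
      \<open>L\<close> vanish at a vertex column.\<close>
    assume "\<not> Re (h r) > 0"
    then have "shifted_col i (a r) (- h r) \<in> vertex_cols i q a"
      using that unfolding vertex_cols_def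
      by (intro insertI2 CollectI exI[of _ r] exI[of _ "- h r"]) auto
    from nz[OF this] show False using g by (simp add: L_shift h_def)
  qed
  have "L (\<lambda>j. of_real (\<Sum>r<q. t r * a r j)) = (\<Sum>r<q. of_real (t r) * L (\<lambda>j. of_real (a r j)))"
    unfolding L_def sum_distrib_left of_real_sum sum_distrib_right
    by (subst sum.swap) (simp add: mult.assoc)
  also have "\<dots> = (\<Sum>r<q. of_real (t r) * h r) * g"
    using g by (simp add: h_def sum_distrib_right)
  finally have "L x = ((\<Sum>r<q. of_real (t r) * h r) + w) * g"
    by (simp add: x_eq L_shift algebra_simps)
  moreover have "(\<Sum>r<q. t r * Re (h r)) > 0"
  proof -
    obtain r where "r < q" "t r > 0" using pos by blast
    then show ?thesis using h t
      by (intro sum_pos2[of _ r]) (auto simp: less_imp_le)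
  qed
  then have "Re ((\<Sum>r<q. of_real (t r) * h r) + w) > 0"
    using w by simp
  then have "(\<Sum>r<q. of_real (t r) * h r) + w \<noteq> 0" by force
  ultimately show ?thesis using g by simp
qed

lemma col_det_nonzero_on_cone_cols:
  assumes nz: "\<And>c. (\<And>i. i < m \<Longrightarrow> c i \<in> vertex_cols i (p i) (a i)) \<Longrightarrow> col_det m c \<noteq> 0"
    and c: "\<And>i. i < m \<Longrightarrow> c i \<in> cone_cols i (p i) (a i)"
  shows "col_det m c \<noteq> 0"
proof -
  \<comment> \<open>Hybrid form for the induction: the first \<open>k\<close> columns are of cone
    type, the others of vertex type; \<open>k = m\<close> is the claim.\<close>
  have "col_det m c \<noteq> 0"
    if "k \<le> m" "\<And>i. i < k \<Longrightarrow> c i \<in> cone_cols i (p i) (a i)"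
      "\<And>i. k \<le> i \<Longrightarrow> i < m \<Longrightarrow> c i \<in> vertex_cols i (p i) (a i)" for k c
    using that
  proof (induction k arbitrary: c)
    case 0
    then show ?case by (intro nz) auto
  next
    case (Suc k)
    have k: "k < m" using Suc.prems(1) by simp
    obtain f where f: "\<And>x. col_det m (c(k := x)) = (\<Sum>j<m. x j * f j)"
      using col_det_linear[OF k] by blast
    \<comment> \<open>With a vertex column in place \<open>k\<close>, only the first
      \<open>k\<close> columns need the cone condition, so the induction hypothesis applies to
      \<open>c(k := x)\<close>.\<close>
    have "(\<Sum>j<m. x j * f j) \<noteq> 0" if "x \<in> vertex_cols k (p k) (a k)" for x
      unfolding f[symmetric] using Suc.prems that by (intro Suc.IH) auto
    from linear_nonzero_on_cone_cols[OF k this Suc.prems(2)[OF lessI]]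
    show ?case using f[of "c k"] by simp
  qed
  from this[OF order_refl c] show ?thesis by auto
qed

section \<open>Nonsingularity from the Lyapunov inequality\<close>

lemma Re_hermitian_form_real_coeffs:
  "Re (\<Sum>i<m. cnj (y i) * (\<Sum>j<m. of_real (B i j) * y j)) =
     (\<Sum>i<m. \<Sum>j<m. Re (y i) * B i j * Re (y j)) +
     (\<Sum>i<m. \<Sum>j<m. Im (y i) * B i j * Im (y j))"
  \<comment> \<open>As \<open>B\<close> is real, mixed products of real and imaginary parts enter
    only the imaginary part.\<close>
  by (simp add: sum_distrib_left sum.distrib[symmetric] algebra_simps)

text \<open>Energy argument: for \<open>y\<close>, the rescaled part of the kernel vector on the
  shifted columns, the kernel equations make the real part of the Hermitian form with coefficients
  \<open>M i j * d j\<close> at most 0, which positivity allows only for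
  \<open>y = 0\<close>.\<close>

lemma diagonally_scaled_positive_kernel_trivial:
  fixes M :: "nat \<Rightarrow> nat \<Rightarrow> real" and v :: "nat \<Rightarrow> complex"
  assumes d: "\<And>i. i < m \<Longrightarrow> d i > 0"
    and pos: "\<And>x. \<exists>i<m. x i \<noteq> 0 \<Longrightarrow> 0 < (\<Sum>i<m. \<Sum>j<m. x i * (M i j * d j) * x j)"
    and c: "\<And>i. i < m \<Longrightarrow> c i = unit_col i \<or> Re (w i) \<ge> 0 \<and> c i = shifted_col i (\<lambda>j. M j i) (w i)"
    and ker: "\<And>j. j < m \<Longrightarrow> (\<Sum>i<m. c i j * v i) = 0"
    and "i < m"
  shows "v i = 0"
proof -
  \<comment> \<open>Zero at unit columns, so that \<open>s\<close> collects the shifted columns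
    only.\<close>
  define y where "y i = (if c i = unit_col i then 0 else v i / of_real (d i))" for i
  define s where "s j = (\<Sum>i<m. of_real (M j i * d i) * y i)" for j
  define u where "u i = (if c i = unit_col i then 1 else w i)" for i
  have row: "s j + u j * v j = 0" if j: "j < m" for j
  proof -
    have "c i j * v i = of_real (M j i * d i) * y i + (if i = j then u j * v j else 0)"
      if "i < m" for i
      using c[OF that] d[OF that]
      by (cases "c i = unit_col i") (auto simp: y_def u_def shifted_col_def unit_col_def algebra_simps)
    then have "(\<Sum>i<m. c i j * v i) = s j + (\<Sum>i<m. if i = j then u j * v j else 0)"
      by (simp add: s_def sum.distrib)
    then show ?thesis using ker[OF j] j by simp
  qed
  \<comment> \<open>At a shifted column the row equation turns the product into \<open>- w i\<close>
    times the nonnegative number \<open>d i * (cmod (y i))\<^sup>2\<close>.\<close>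
  have "Re (cnj (y i) * s i) \<le> 0" if "i < m" for i
  proof (cases "c i = unit_col i")
    case False
    have "s i = - (w i * v i)" using row[OF that] False by (simp add: u_def add_eq_0_iff)
    also have "v i = of_real (d i) * y i" using False d[OF that] by (simp add: y_def)
    finally have "cnj (y i) * s i = - (w i * of_real (d i * (cmod (y i))\<^sup>2))"
      by (simp add: complex_norm_square del: of_real_power)
    moreover have "Re (w i) \<ge> 0" using c[OF that] False by auto
    ultimately show ?thesis using d[OF that] by simp
  qed (simp add: y_def)
  then have "Re (\<Sum>i<m. cnj (y i) * s i) \<le> 0"
    unfolding Re_sum by (intro sum_nonpos) auto
  then have le: "(\<Sum>i<m. \<Sum>j<m. Re (y i) * (M i j * d j) * Re (y j)) +
     (\<Sum>i<m. \<Sum>j<m. Im (y i) * (M i j * d j) * Im (y j)) \<le> 0"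
    unfolding s_def Re_hermitian_form_real_coeffs .
  have nonneg: "0 \<le> (\<Sum>i<m. \<Sum>j<m. x i * (M i j * d j) * x j)" for x
  proof (cases "\<exists>i<m. x i \<noteq> 0")
    case True
    then show ?thesis using pos by (simp add: less_imp_le)
  next
    case False
    then show ?thesis by simp
  qed
  have "y i = 0" if "i < m" for i
  proof -
    have "\<not> (\<exists>i<m. Re (y i) \<noteq> 0)"
      using pos[of "\<lambda>i. Re (y i)"] nonneg[of "\<lambda>i. Im (y i)"] le by (meson add_pos_nonneg not_le)
    moreover have "\<not> (\<exists>i<m. Im (y i) \<noteq> 0)"
      using pos[of "\<lambda>i. Im (y i)"] nonneg[of "\<lambda>i. Re (y i)"] le by (meson add_nonneg_pos not_le)
    ultimately show ?thesis using that by (simp add: complex_eq_iff)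
  qed
  \<comment> \<open>At unit columns \<open>y\<close> carries no information on \<open>v\<close>;
    there the row equation with \<open>s i = 0\<close> gives \<open>v i = 0\<close>.\<close>
  moreover from this have "s i = 0" by (simp add: s_def)
  ultimately show "v i = 0"
    using row[OF \<open>i < m\<close>] d[OF \<open>i < m\<close>] \<open>i < m\<close>
    by (cases "c i = unit_col i") (fastforce simp: y_def u_def)+
qed

text \<open>The quadratic form of \<open>M * D + D * transpose_mat M\<close> is twice that of
  \<open>M * D\<close>.\<close>

lemma volterra_lyapunov_stable_quadratic_form:
  assumes "volterra_lyapunov_stable m M" and M: "M \<in> carrier_mat m m"
  shows "\<exists>d. (\<forall>i<m. d i > 0) \<and>
    (\<forall>x. (\<exists>i<m. x i \<noteq> 0) \<longrightarrow> 0 < (\<Sum>i<m. \<Sum>j<m. x i * (M $$ (i, j) * d j) * x j))"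
proof -
  obtain D where D: "D \<in> carrier_mat m m" "diagonal_mat D" "\<And>i. i < m \<Longrightarrow> D $$ (i, i) > 0"
    and pd: "sym_positive_definite m (M * D + D * transpose_mat M)"
    using assms by (auto simp: volterra_lyapunov_stable_def)
  define B where "B i j = M $$ (i, j) * D $$ (j, j)" for i j
  have off: "D $$ (i, j) = 0" if "i < m" "j < m" "i \<noteq> j" for i j
    using D that by (auto simp: diagonal_mat_def)
  have idx: "(M * D + D * transpose_mat M) $$ (i, j) = B i j + B j i"
    if ij: "i < m" "j < m" for i j
  proof -
    have "(M * D) $$ (i, j) = (\<Sum>k<m. M $$ (i, k) * D $$ (k, j))"
      using M D ij by (simp add: scalar_prod_def lessThan_atLeast0)
    also have "\<dots> = (\<Sum>k<m. if k = j then B i j else 0)"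
      using off ij by (intro sum.cong) (auto simp: B_def)
    finally have 1: "(M * D) $$ (i, j) = B i j" using ij by simp
    have "(D * transpose_mat M) $$ (i, j) = (\<Sum>k<m. D $$ (i, k) * M $$ (j, k))"
      using M D ij by (simp add: scalar_prod_def lessThan_atLeast0)
    also have "\<dots> = (\<Sum>k<m. if k = i then B j i else 0)"
      using off ij by (intro sum.cong) (auto simp: B_def)
    finally have 2: "(D * transpose_mat M) $$ (i, j) = B j i" using ij by simp
    show ?thesis using 1 2 M D ij by simp
  qed
  have "0 < (\<Sum>i<m. \<Sum>j<m. x i * B i j * x j)" if "\<exists>i<m. x i \<noteq> 0" for x
  proof -
    have "vec m x \<noteq> 0\<^sub>v m" using that by (metis index_vec index_zero_vec(1))
    then have "0 < vec m x \<bullet> ((M * D + D * transpose_mat M) *\<^sub>v vec m x)"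
      using pd by (auto simp: sym_positive_definite_def)
    also have "\<dots> = (\<Sum>i<m. x i * (\<Sum>j<m. (B i j + B j i) * x j))"
      using M D by (simp add: scalar_prod_def lessThan_atLeast0 idx[symmetric])
    also have "\<dots> = (\<Sum>i<m. \<Sum>j<m. x i * B i j * x j) + (\<Sum>i<m. \<Sum>j<m. x i * B j i * x j)"
      by (simp add: sum_distrib_left sum.distrib algebra_simps)
    also have "(\<Sum>i<m. \<Sum>j<m. x i * B j i * x j) = (\<Sum>i<m. \<Sum>j<m. x i * B i j * x j)"
      by (subst sum.swap) (simp add: algebra_simps)
    finally show ?thesis by simp
  qed
  with D(3) show ?thesis unfolding B_def by (intro exI[of _ "\<lambda>i. D $$ (i, i)"]) blast
qed

section \<open>Block numbering of the columns and the product with \<open>K\<close>\<close>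

lemma pair_index_less:
  assumes "i < m" "r < p i"
  shows "pair_index p i r < (\<Sum>i<m. p i)"
proof -
  have "pair_index p i r < (\<Sum>j<Suc i. p j)" using assms by (simp add: pair_index_def)
  also have "\<dots> \<le> (\<Sum>j<m. p j)" using assms by (intro sum_mono2) auto
  finally show ?thesis .
qed

lemma pair_index_eq_iff:
  assumes "r < p i" "s < p j"
  shows "pair_index p i r = pair_index p j s \<longleftrightarrow> i = j \<and> r = s"
proof -
  \<comment> \<open>Block \<open>i\<close> ends before block \<open>j\<close> starts: this is
    \<open>pair_index_less\<close> with \<open>j\<close> in place of \<open>m\<close>.\<close>
  have "pair_index p i r < pair_index p j s" if "i < j" "r < p i" for i j r s
    using pair_index_less[of i j r p] that by (simp add: pair_index_def)
  then show ?thesis using assms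
    by (metis add_left_cancel less_irrefl linorder_neqE_nat pair_index_def)
qed

text \<open>Rows carry a single number, so membership in block \<open>i\<close> is tested by the
  image of \<open>pair_index\<close> rather than by decoding the pair.\<close>

definition block_ones :: "nat \<Rightarrow> nat \<Rightarrow> (nat \<Rightarrow> nat) \<Rightarrow> real mat" where
  "block_ones m n p = mat n m (\<lambda>(c, i). if c \<in> pair_index p i ` {..<p i} then 1 else 0)"

lemma block_diagonal_nonneg_block_ones:
  "block_diagonal_nonneg m (\<Sum>i<m. p i) p (block_ones m (\<Sum>i<m. p i) p)"
  unfolding block_diagonal_nonneg_def block_ones_def
  by (auto simp: pair_index_less pair_index_eq_iff)

text \<open>Puts column \<open>i\<close> of the product in the form used by
  \<open>cone_cols\<close>, with the diagonal of \<open>E\<close> as weights.\<close>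

lemma index_mult_block_ones:
  assumes A: "A \<in> carrier_mat m (\<Sum>i<m. p i)" and E: "nonneg_diagonal (\<Sum>i<m. p i) E"
    and "j < m" "i < m"
  shows "(A * E * block_ones m (\<Sum>i<m. p i) p) $$ (j, i) =
    (\<Sum>r<p i. E $$ (pair_index p i r, pair_index p i r) * A $$ (j, pair_index p i r))"
proof -
  let ?n = "\<Sum>i<m. p i"
  have EC: "E \<in> carrier_mat ?n ?n" and off: "\<And>k l. k < ?n \<Longrightarrow> l < ?n \<Longrightarrow> k \<noteq> l \<Longrightarrow> E $$ (k, l) = 0"
    using E by (auto simp: nonneg_diagonal_def diagonal_mat_def)
  have AE: "(A * E) $$ (j, l) = A $$ (j, l) * E $$ (l, l)" if "l < ?n" for l
  proof -
    have "(A * E) $$ (j, l) = (\<Sum>k<?n. A $$ (j, k) * E $$ (k, l))"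
      using A EC that \<open>j < m\<close> by (simp add: scalar_prod_def lessThan_atLeast0)
    also have "\<dots> = (\<Sum>k<?n. if k = l then A $$ (j, l) * E $$ (l, l) else 0)"
      using off that by (intro sum.cong) auto
    finally show ?thesis using that by simp
  qed
  have "(A * E * block_ones m ?n p) $$ (j, i) =
      (\<Sum>l<?n. (A * E) $$ (j, l) * block_ones m ?n p $$ (l, i))"
    using A EC assms(3,4) by (simp add: scalar_prod_def lessThan_atLeast0 block_ones_def)
  also have "\<dots> = (\<Sum>l<?n. if l \<in> pair_index p i ` {..<p i} then A $$ (j, l) * E $$ (l, l) else 0)"
    using \<open>i < m\<close> by (intro sum.cong) (auto simp: AE block_ones_def)
  also have "\<dots> = (\<Sum>l \<in> pair_index p i ` {..<p i}. A $$ (j, l) * E $$ (l, l))"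
    using pair_index_less[OF \<open>i < m\<close>]
    by (subst sum.inter_restrict[symmetric]) (auto intro!: sum.cong)
  also have "\<dots> = (\<Sum>r<p i. A $$ (j, pair_index p i r) * E $$ (pair_index p i r, pair_index p i r))"
    by (subst sum.reindex) (auto simp: inj_on_def pair_index_eq_iff)
  finally show ?thesis by (simp add: mult.commute)
qed

section \<open>Eigenvectors of principal submatrices\<close>

lemma bij_betw_pick:
  assumes "finite S"
  shows "bij_betw (pick S) {..<card S} S"
proof -
  have "inj_on (pick S) {..<card S}"
    by (rule inj_onI) (metis lessThan_iff card_pick_le)
  moreover have "pick S ` {..<card S} \<subseteq> S" using pick_in_set_le by auto
  ultimately show ?thesis
    by (metis assms bij_betw_def card_image card_lessThan card_subset_eq)
qed

text \<open>Moves an eigenvector from the compressed indices of \<open>submatrix\<close> back to the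
  original indices in \<open>J\<close>; the values of \<open>v\<close> outside \<open>J\<close> are
  left unspecified.\<close>

lemma eigenvalue_principal_submatrixE:
  fixes M :: "complex mat"
  assumes M: "M \<in> carrier_mat m m" and J: "J \<subseteq> {..<m}" and ev: "eigenvalue (submatrix M J J) z"
  obtains v where "\<exists>i\<in>J. v i \<noteq> 0" and "\<And>j. j \<in> J \<Longrightarrow> (\<Sum>i\<in>J. M $$ (j, i) * v i) = z * v j"
proof -
  have fin: "finite J" using J finite_subset by blast
  have J_eq: "{i. i < m \<and> i \<in> J} = J" using J by auto
  let ?k = "card J"
  let ?S = "submatrix M J J"
  have S: "?S \<in> carrier_mat ?k ?k" using M by (simp add: submatrix_def J_eq)
  obtain u where u: "u \<in> carrier_vec ?k" "u \<noteq> 0\<^sub>v ?k" "?S *\<^sub>v u = z \<cdot>\<^sub>v u"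
    using ev S by (auto simp: eigenvalue_def eigenvector_def)
  note bij = bij_betw_pick[OF fin]
  define v where "v i = u $ (the_inv_into {..<?k} (pick J) i)" for i
  have v: "v (pick J b) = u $ b" if "b < ?k" for b
    using bij that by (simp add: v_def the_inv_into_f_f bij_betw_def)
  obtain b where b: "b < ?k" "u $ b \<noteq> 0"
    using u(1,2) by (metis carrier_vecD eq_vecI index_zero_vec)
  have "\<exists>i\<in>J. v i \<noteq> 0" using b v by (metis pick_in_set_le)
  moreover have "(\<Sum>i\<in>J. M $$ (j, i) * v i) = z * v j" if j: "j \<in> J" for j
  proof -
    obtain l where l: "l < ?k" "j = pick J l" using bij j by (auto simp: bij_betw_def)
    have "(\<Sum>i\<in>J. M $$ (j, i) * v i) = (\<Sum>b<?k. M $$ (j, pick J b) * v (pick J b))"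
      by (rule sum.reindex_bij_betw[OF bij, symmetric])
    also have "\<dots> = (\<Sum>b<?k. ?S $$ (l, b) * u $ b)"
      using M l by (intro sum.cong) (auto simp: v submatrix_def J_eq)
    also have "\<dots> = (?S *\<^sub>v u) $ l"
      using S u(1) l by (simp add: scalar_prod_def lessThan_atLeast0)
    also have "\<dots> = z * v j" using u l by (simp add: v)
    finally show ?thesis .
  qed
  ultimately show ?thesis using that by blast
qed

section \<open>From individual stability to D-stability\<close>

lemma individually_VL_stable_col_det_nonzero:
  assumes p: "\<And>i. i < m \<Longrightarrow> 1 \<le> p i"
    and A: "A \<in> carrier_mat m (\<Sum>i<m. p i)" and VL: "individually_VL_stable m p A"
    and c: "\<And>i. i < m \<Longrightarrow> c i \<in> vertex_cols i (p i) (\<lambda>r j. A $$ (j, pair_index p i r))"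
  shows "col_det m c \<noteq> 0"
proof
  assume "col_det m c = 0"
  then obtain v where nz: "\<exists>i<m. v i \<noteq> 0" and ker: "\<And>j. j < m \<Longrightarrow> (\<Sum>i<m. c i j * v i) = 0"
    by (auto simp: col_det_eq_0_iff)
  \<comment> \<open>A unit column determines no \<open>r\<close>, yet \<kappa> must select a column
    in every block; any \<open>r\<close> serves, and one exists since \<open>p i\<close> is at least
    1.\<close>
  have "\<forall>i. \<exists>r w. i < m \<longrightarrow> r < p i \<and> (c i = unit_col i \<or>
      Re w \<ge> 0 \<and> c i = shifted_col i (\<lambda>j. A $$ (j, pair_index p i r)) w)"
    using c p unfolding vertex_cols_def by (force simp: Suc_le_eq)
  then obtain \<kappa> w where \<kappa>: "\<And>i. i < m \<Longrightarrow> \<kappa> i < p i"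
    and cw: "\<And>i. i < m \<Longrightarrow> c i = unit_col i \<or>
      Re (w i) \<ge> 0 \<and> c i = shifted_col i (\<lambda>j. A $$ (j, pair_index p i (\<kappa> i))) (w i)"
    by metis
  let ?M = "squared_matrix m p A \<kappa>"
  have M: "?M \<in> carrier_mat m m"
    by (simp add: squared_matrix_def mat_of_cols_def)
  have M_idx: "?M $$ (j, i) = A $$ (j, pair_index p i (\<kappa> i))" if "j < m" "i < m" for i j
    using that A pair_index_less[of i m "\<kappa> i" p] \<kappa>
    by (simp add: squared_matrix_def mat_of_cols_index)
  have stable: "volterra_lyapunov_stable m ?M"
    using VL \<kappa> by (simp add: individually_VL_stable_def)
  obtain d where d: "\<And>i. i < m \<Longrightarrow> d i > 0"
    and pos: "\<And>x. \<exists>i<m. x i \<noteq> 0 \<Longrightarrow> 0 < (\<Sum>i<m. \<Sum>j<m. x i * (?M $$ (i, j) * d j) * x j)"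
    using volterra_lyapunov_stable_quadratic_form[OF stable M] by blast
  have "0 < (\<Sum>i<m. \<Sum>j<m. x i * (A $$ (i, pair_index p j (\<kappa> j)) * d j) * x j)"
    if "\<exists>i<m. x i \<noteq> 0" for x
    using pos[OF that] by (simp add: M_idx)
  from diagonally_scaled_positive_kernel_trivial[OF d this cw ker] nz
  show False by blast
qed

theorem theorem1:
  fixes m n :: nat and p :: "nat \<Rightarrow> nat" and A :: "real mat"
  assumes "0 < m" and "m < n"
    and "\<And>i. i < m \<Longrightarrow> 1 \<le> p i"
    and "(\<Sum>i<m. p i) = n"
    and "A \<in> carrier_mat m n"
    and "individually_VL_stable m p A"
  shows "D_stable m n p A"
  unfolding D_stable_def
proof (intro exI conjI allI impI; (elim conjE)?)
  let ?K = "block_ones m n p"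
  show "block_diagonal_nonneg m n p ?K"
    using block_diagonal_nonneg_block_ones[of m p] assms(4) by simp
  fix E J
  assume E: "nonneg_diagonal n E" and J: "J \<subseteq> active_blocks m p E"
  let ?a = "\<lambda>i r j. A $$ (j, pair_index p i r)"
  let ?e = "\<lambda>i r. E $$ (pair_index p i r, pair_index p i r)"
  let ?M = "A * E * ?K"
  let ?MC = "map_mat complex_of_real ?M"
  have Jm: "J \<subseteq> {..<m}" using J by (auto simp: active_blocks_def)
  have M: "?M \<in> carrier_mat m m"
    using carrier_matD[OF assms(5)] by (intro carrier_matI) (auto simp: block_ones_def)
  have M_idx: "?M $$ (j, i) = (\<Sum>r<p i. ?e i r * ?a i r j)" if "j < m" "i < m" for i j
    using index_mult_block_ones[of A m p E j i] assms(4,5) E that by simp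
  have MC_idx: "?MC $$ (j, i) = of_real (\<Sum>r<p i. ?e i r * ?a i r j)" if "j < m" "i < m" for i j
    using carrier_matD[OF M] that by (subst index_map_mat(1)) (simp_all only: M_idx)
  \<comment> \<open>\<open>positive_stable\<close> passes to complex entries after taking the
    submatrix, whereas the eigenvector is extracted from a submatrix of \<open>?MC\<close>.\<close>
  have sub: "map_mat complex_of_real (submatrix ?M J J) = submatrix ?MC J J"
  proof (rule eq_matI)
    fix i j assume "i < dim_row (submatrix ?MC J J)" "j < dim_col (submatrix ?MC J J)"
    then have ij: "i < card {k. k < dim_row ?M \<and> k \<in> J}" "j < card {k. k < dim_col ?M \<and> k \<in> J}"
      by (simp_all add: dim_submatrix)
    then show "map_mat complex_of_real (submatrix ?M J J) $$ (i, j) = submatrix ?MC J J $$ (i, j)"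
      using pick_le[OF ij(1)] pick_le[OF ij(2)] by (simp add: submatrix_def)
  qed (simp_all add: dim_submatrix)
  show "positive_stable (submatrix ?M J J)"
    unfolding positive_stable_def
  proof (intro allI impI, rule ccontr)
    fix z assume "eigenvalue (map_mat complex_of_real (submatrix ?M J J)) z" and z: "\<not> Re z > 0"
    then obtain v where v_nz: "\<exists>i\<in>J. v i \<noteq> 0"
      and v: "\<And>j. j \<in> J \<Longrightarrow> (\<Sum>i\<in>J. ?MC $$ (j, i) * v i) = z * v j"
      using eigenvalue_principal_submatrixE[of ?MC m J z] M Jm sub by auto
    define c where "c i = (if i \<in> J then shifted_col i (\<lambda>j. \<Sum>r<p i. ?e i r * ?a i r j) (- z)
      else unit_col i)" for i
    \<comment> \<open>Outside \<open>J\<close> the unit column acts on row \<open>j\<close> alone,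
      so this value cancels what the columns in \<open>J\<close> leave there; inside
      \<open>J\<close> the eigenvalue equation makes the row vanish.\<close>
    define u where "u j = (if j \<in> J then v j else - (\<Sum>i\<in>J. ?MC $$ (j, i) * v i))" for j
    have "c i \<in> cone_cols i (p i) (?a i)" if "i < m" for i
    proof (cases "i \<in> J")
      case True
      \<comment> \<open>Activity of the block provides the positive weight in
        \<open>cone_cols\<close>.\<close>
      then have "\<exists>r<p i. ?e i r > 0" using J by (auto simp: active_blocks_def)
      moreover have "\<forall>r<p i. ?e i r \<ge> 0"
        using E pair_index_less[OF that] assms(4) by (auto simp: nonneg_diagonal_def)
      ultimately have "shifted_col i (\<lambda>j. \<Sum>r<p i. ?e i r * ?a i r j) (- z) \<in> cone_cols i (p i) (?a i)"
        using z unfolding cone_cols_def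
        by (intro insertI2 CollectI exI[of _ "\<lambda>r. ?e i r"] exI[of _ "- z"]) auto
      then show ?thesis using True by (simp add: c_def)
    qed (simp add: c_def cone_cols_def)
    moreover have "col_det m b \<noteq> 0" if "\<And>i. i < m \<Longrightarrow> b i \<in> vertex_cols i (p i) (?a i)" for b
      using individually_VL_stable_col_det_nonzero[of m p A b] assms that by simp
    ultimately have "col_det m c \<noteq> 0" by (intro col_det_nonzero_on_cone_cols[of m p ?a c]) auto
    moreover have "(\<Sum>i<m. c i j * u i) = 0" if j: "j < m" for j
    proof -
      \<comment> \<open>The first term is the \<open>?MC\<close> part of a column in
        \<open>J\<close>; the second is the unit-vector part, with coefficient \<open>- z\<close> or
        1.\<close>
      have "c i j * u i = (if i \<in> J then ?MC $$ (j, i) * v i else 0) +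
          (if i = j then (if j \<in> J then - z else 1) * u j else 0)" if "i < m" for i
          using MC_idx[OF j that]
          by (auto simp: c_def u_def shifted_col_def unit_col_def simp del: index_map_mat) (simp_all add: algebra_simps)
      then have "(\<Sum>i<m. c i j * u i) = (\<Sum>i<m. if i \<in> J then ?MC $$ (j, i) * v i else 0) +
          (if j \<in> J then - z else 1) * u j"
        using j by (simp add: sum.distrib)
      also have "(\<Sum>i<m. if i \<in> J then ?MC $$ (j, i) * v i else 0) = (\<Sum>i\<in>J. ?MC $$ (j, i) * v i)"
        using Jm by (subst sum.inter_restrict[symmetric]) (auto simp: Int_absorb1)
      finally show ?thesis using v by (simp add: u_def)
    qed
    moreover have "\<exists>i<m. u i \<noteq> 0" using v_nz Jm by (auto simp: u_def)
    ultimately show False by (auto simp: col_det_eq_0_iff)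
  qed
qed

end
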